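(* Let $A=M_n(\mathbb{C})$, let $\psi$ be a state on $A$, let $a_1,a_2\in A_{sa}$, let $\Delta_1,\Delta_2\subseteq\mathbb{R}$ be open, and let $C\in\mathcal{C}$. If $\underline{[a\in\Delta]}$ is defined using $\delta^{o}(\chi_{\Delta}(a))$, then the following two conditions are equivalent in the contravariant model: 1. $C\Vdash\underline{\mu}(\underline{[a_{1}\in\Delta_{1}]}\vee\underline{[a_{2}\in\Delta_{2}]})=\underline{1}$; 2. If $p\in\mathrm{Proj}(C)$ satisfies $p\geq\chi_{\Delta_{1}}(a_{1})$ and $p\geq\chi_{\Delta_{2}}(a_{2})$, then $\psi(p)=1$.
   Context: Contravariant model: $\mathcal{C}$ is the poset (under inclusion) of abelian von Neumann subalgebras of $A$ (containing the unit of $A$); the topos is $[\mathcal{C}^{op},\mathbf{Set}]$. $\Sigma_C$ is the Gelfand spectrum of $C$. $\Sigma_{\downarrow}=\coprod_C\Sigma_C$ with $U$ open iff (1) $(C,\lambda)\in U$ and $D\subseteq C$ imply $(D,\lambda|_D)\in U$, and (2) $U_C:=U\cap\Sigma_C$ is open in $\Sigma_C$ for all $C$. $\mathcal{O}\Sigma_{\downarrow}$ is a complete Heyting algebra under inclusion, and the connective $\vee$ is taken in it. For a projection $p\in A$, $\delta^o(p)_C=\bigwedge\{q\in\mathrm{Proj}(C)\mid q\geq p\}$. The elementary proposition $\underline{[a\in\Delta]}$ is (externally) the open $[a\in\Delta]=\{(C,\lambda)\in\Sigma_{\downarrow}\mid\lambda(\delta^o(\chi_\Delta(a))_C)=1\}$,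 where $\chi_\Delta(a)$ is the spectral projection. $\underline{\mu}$ is the internal probability valuation associated to $\psi$: externally $\mu(U)(C)=\mu^{C}(U_C)$ for $U\in\mathcal{O}\Sigma_{\downarrow}$, with $\mu^C:\mathcal{O}\Sigma_C\to[0,1]$ the probability valuation corresponding to $\psi|_C$ by Riesz–Markov (so if $U_C$ is the clopen set corresponding to the projection $p_C\in C$, then $\mu(U)(C)=\psi(p_C)$). By presheaf semantics, $C\Vdash\underline{\mu}(\underline{U})=\underline{1}$ means $\mu(U)(D)=1$ for all $D\subseteq C$. *)

theory Defs
  imports "HOL-Analysis.Analysis" "HOL-Algebra.Lattice"
begin

section \<open>The C*-algebra of complex n x n matrices\<close>

type_synonym 'n cmat = "complex ^ 'n ^ 'n"

definition adj :: "'n::finite cmat \<Rightarrow> 'n cmat" where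
  "adj a = map_matrix cnj (transpose a)"

text \<open>The inherited \<open>scaleR\<close> only covers real scalars.\<close>

definition cscale :: "complex \<Rightarrow> 'n::finite cmat \<Rightarrow> 'n cmat" where
  "cscale z a = map_matrix (\<lambda>w. z * w) a"

definition self_adjoint :: "'n::finite cmat \<Rightarrow> bool" where
  "self_adjoint a \<longleftrightarrow> adj a = a"

definition positive :: "'n::finite cmat \<Rightarrow> bool" where
  "positive a \<longleftrightarrow> (\<exists>b. a = adj b ** b)"

definition op_le :: "'n::finite cmat \<Rightarrow> 'n cmat \<Rightarrow> bool" (infix \<open>\<preceq>\<close> 50) where
  "a \<preceq> b \<longleftrightarrow> positive (b - a)"

definition projection :: "'n::finite cmat \<Rightarrow> bool" where
  "projection p \<longleftrightarrow> self_adjoint p \<and> p ** p = p"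

definition clinear_on :: "'n::finite cmat set \<Rightarrow> ('n cmat \<Rightarrow> complex) \<Rightarrow> bool" where
  "clinear_on S f \<longleftrightarrow>
     (\<forall>a\<in>S. \<forall>b\<in>S. f (a + b) = f a + f b) \<and> (\<forall>z. \<forall>a\<in>S. f (cscale z a) = z * f a)"

definition state :: "('n::finite cmat \<Rightarrow> complex) \<Rightarrow> bool" where
  "state \<psi> \<longleftrightarrow> clinear_on UNIV \<psi> \<and> (\<forall>a. positive a \<longrightarrow> \<psi> a \<in> \<real>\<^sub>\<ge>\<^sub>0) \<and> \<psi> (mat 1) = 1"


section \<open>Spectral projections\<close>

definition real_eigenvalues :: "'n::finite cmat \<Rightarrow> real set" where
  "real_eigenvalues a = {t. \<exists>v. v \<noteq> 0 \<and> a *v v = complex_of_real t *s v}"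

text \<open>The orthogonal projection onto the kernel of \<open>a - t\<close>, pinned down by its range, which
  is its set of fixed vectors.\<close>

definition eigenprojection :: "'n::finite cmat \<Rightarrow> real \<Rightarrow> 'n cmat" where
  "eigenprojection a t =
     (THE p. projection p \<and> (\<forall>v. p *v v = v \<longleftrightarrow> a *v v = complex_of_real t *s v))"

text \<open>The spectral measure of a self-adjoint matrix, whose spectrum consists of finitely many real
  eigenvalues.\<close>

definition spectral_projection :: "real set \<Rightarrow> 'n::finite cmat \<Rightarrow> 'n cmat" where
  "spectral_projection \<Delta> a = (\<Sum>t\<in>real_eigenvalues a \<inter> \<Delta>. eigenprojection a t)"


section \<open>Contexts and outer daseinisation\<close>

definition commutant :: "'n::finite cmat set \<Rightarrow> 'n cmat set" where
  "commutant S = {b. \<forall>a\<in>S. a ** b = b ** a}"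

definition von_neumann_subalgebra :: "'n::finite cmat set \<Rightarrow> bool" where
  "von_neumann_subalgebra C \<longleftrightarrow>
     mat 1 \<in> C \<and>
     (\<forall>a\<in>C. \<forall>b\<in>C. a + b \<in> C \<and> a ** b \<in> C) \<and>
     (\<forall>z. \<forall>a\<in>C. cscale z a \<in> C) \<and>
     (\<forall>a\<in>C. adj a \<in> C) \<and>
     commutant (commutant C) = C"

definition contexts :: "'n::finite cmat set set" where
  "contexts = {C. von_neumann_subalgebra C \<and> (\<forall>a\<in>C. \<forall>b\<in>C. a ** b = b ** a)}"

definition Proj :: "'n::finite cmat set \<Rightarrow> 'n cmat set" where
  "Proj C = {p \<in> C. projection p}"

definition Proj_lattice :: "'n::finite cmat set \<Rightarrow> 'n cmat gorder" where
  "Proj_lattice C = \<lparr>carrier = Proj C, eq = (=), le = (\<preceq>)\<rparr>"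

definition outer_daseinisation :: "'n::finite cmat \<Rightarrow> 'n cmat set \<Rightarrow> 'n cmat" where
  "outer_daseinisation p C = \<Sqinter>\<^bsub>Proj_lattice C\<^esub> {q \<in> Proj C. p \<preceq> q}"


section \<open>Gelfand spectra and the spectral presheaf\<close>

text \<open>A character of \<open>C\<close> is a function on all matrices that is \<open>undefined\<close> outside \<open>C\<close>, so that
  equality of such functions is equality on \<open>C\<close>.\<close>

definition characters :: "'n::finite cmat set \<Rightarrow> ('n cmat \<Rightarrow> complex) set" where
  "characters C = {l \<in> extensional C. clinear_on C l \<and>
     (\<forall>a\<in>C. \<forall>b\<in>C. l (a ** b) = l a * l b) \<and> l (mat 1) = 1}"

text \<open>The weak-* topology, i.e. pointwise convergence on \<open>C\<close>.\<close>

definition gelfand_spectrum :: "'n::finite cmat set \<Rightarrow> ('n cmat \<Rightarrow> complex) topology" where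
  "gelfand_spectrum C = subtopology (product_topology (\<lambda>_. euclidean) C) (characters C)"

definition Sigma_down :: "('n::finite cmat set \<times> ('n cmat \<Rightarrow> complex)) set" where
  "Sigma_down = (SIGMA C:contexts. characters C)"

definition fibre :: "('n::finite cmat set \<times> ('n cmat \<Rightarrow> complex)) set \<Rightarrow> 'n cmat set
    \<Rightarrow> ('n cmat \<Rightarrow> complex) set" where
  "fibre U C = {l. (C, l) \<in> U}"

definition Sigma_opens :: "('n::finite cmat set \<times> ('n cmat \<Rightarrow> complex)) set set" where
  "Sigma_opens = {U. U \<subseteq> Sigma_down \<and>
     (\<forall>C l D. (C, l) \<in> U \<and> D \<in> contexts \<and> D \<subseteq> C \<longrightarrow> (D, restrict l D) \<in> U) \<and>
     (\<forall>C\<in>contexts. openin (gelfand_spectrum C) (fibre U C))}"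

definition Sigma_frame :: "('n::finite cmat set \<times> ('n cmat \<Rightarrow> complex)) set gorder" where
  "Sigma_frame = \<lparr>carrier = Sigma_opens, eq = (=), le = (\<subseteq>)\<rparr>"

definition elementary_proposition :: "'n::finite cmat \<Rightarrow> real set
    \<Rightarrow> ('n cmat set \<times> ('n cmat \<Rightarrow> complex)) set" where
  "elementary_proposition a \<Delta> =
     {(C, l) \<in> Sigma_down. l (outer_daseinisation (spectral_projection \<Delta> a) C) = 1}"


section \<open>The probability valuation of a state\<close>

text \<open>The regular Borel measure representing the restriction of \<open>\<psi>\<close> to \<open>C\<close>, read through the Gelfand
  transform, as in the Riesz-Markov theorem. It is a probability measure because \<open>\<psi> (mat 1) = 1\<close>.\<close>

definition riesz_markov_measure :: "('n::finite cmat \<Rightarrow> complex) \<Rightarrow> 'n cmat set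
    \<Rightarrow> ('n cmat \<Rightarrow> complex) measure" where
  "riesz_markov_measure \<psi> C =
     (THE M. finite_measure M \<and>
        space M = topspace (gelfand_spectrum C) \<and>
        sets M = sigma_sets (topspace (gelfand_spectrum C)) {U. openin (gelfand_spectrum C) U} \<and>
        (\<forall>B\<in>sets M. emeasure M B = (INF U\<in>{U. openin (gelfand_spectrum C) U \<and> B \<subseteq> U}. emeasure M U)) \<and>
        (\<forall>B\<in>sets M. emeasure M B =
           (SUP K\<in>{K. compactin (gelfand_spectrum C) K \<and> K \<subseteq> B}. emeasure M K)) \<and>
        (\<forall>a\<in>C. integrable M (\<lambda>l. l a) \<and> (\<integral>l. l a \<partial>M) = \<psi> a))"

definition valuation :: "('n::finite cmat \<Rightarrow> complex)
    \<Rightarrow> ('n cmat set \<times> ('n cmat \<Rightarrow> complex)) set \<Rightarrow> 'n cmat set \<Rightarrow> real" where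
  "valuation \<psi> U C = measure (riesz_markov_measure \<psi> C) (fibre U C)"

text \<open>Presheaf semantics of the formula stating that the valuation of \<open>U\<close> is 1, at stage \<open>C\<close>.\<close>

definition forces_valuation_one :: "('n::finite cmat \<Rightarrow> complex) \<Rightarrow> 'n cmat set
    \<Rightarrow> ('n cmat set \<times> ('n cmat \<Rightarrow> complex)) set \<Rightarrow> bool" where
  "forces_valuation_one \<psi> C U \<longleftrightarrow> (\<forall>D\<in>contexts. D \<subseteq> C \<longrightarrow> valuation \<psi> U D = 1)"

end

theory Submission
  imports Defs "HOL-Computational_Algebra.Fundamental_Theorem_Algebra"
begin

text \<open>Every context \<open>C\<close> is spanned by finitely many pairwise orthogonal minimal projections with sum 1:
  the range of a minimal projection \<open>e\<close> contains an eigenvector of each \<open>a \<in> C\<close>, and minimality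
  forces \<open>a e = t e\<close>. The characters of \<open>C\<close> are exactly the resulting eigenvalue maps \<open>a \<mapsto> t\<close>, so
  the spectrum is finite and discrete, the Riesz-Markov measure is a point measure, and the set
  \<open>{l. l p = 1}\<close> has measure \<open>\<psi> p\<close> for every projection \<open>p \<in> C\<close>. At a stage \<open>D\<close> the join of the two
  propositions is \<open>{l. l r\<^sub>D = 1}\<close>, where \<open>r\<^sub>D\<close> is the least projection of \<open>D\<close> above both spectral
  projections; the equivalence then follows from monotonicity of \<open>\<psi>\<close> on projections.\<close>

section \<open>Matrix algebra and projections\<close>

lemma adj_nth [simp]: "adj a $ i $ j = cnj (a $ j $ i)"
  by (simp add: adj_def map_matrix_def transpose_def)

lemma cscale_nth [simp]: "cscale z a $ i $ j = z * a $ i $ j"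
  by (simp add: cscale_def map_matrix_def)

lemma adj_adj [simp]: "adj (adj a) = a"
  by (simp add: vec_eq_iff)

lemma adj_mult: "adj (a ** b) = adj b ** adj a"
  by (simp add: vec_eq_iff matrix_matrix_mult_def mult.commute)

lemma adj_add: "adj (a + b) = adj a + adj b"
  and adj_diff: "adj (a - b) = adj a - adj b"
  and adj_zero [simp]: "adj 0 = 0"
  and adj_one [simp]: "adj (mat 1) = mat 1"
  and adj_cscale: "adj (cscale z a) = cscale (cnj z) (adj a)"
  by (auto simp: vec_eq_iff mat_def)

lemma cscale_mult_left: "cscale z a ** b = cscale z (a ** b)"
  and cscale_mult_right: "a ** cscale z b = cscale z (a ** b)"
  by (simp_all add: vec_eq_iff matrix_matrix_mult_def sum_distrib_left mult_ac)

lemma cscale_vec: "cscale z a *v v = z *s (a *v v)"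
  by (simp add: vec_eq_iff matrix_vector_mult_def sum_distrib_left mult_ac)

lemma cscale_minus_one: "cscale (- 1) a = - a"
  and cscale_zero [simp]: "cscale 0 a = 0"
  and cscale_one [simp]: "cscale 1 a = a"
  by (simp_all add: vec_eq_iff)

lemma matrix_diff_mult_distrib:
  fixes a b c :: "'n::finite cmat"
  shows "(a - b) ** c = a ** c - b ** c"
    and "c ** (a - b) = c ** a - c ** b"
  by (simp_all add: vec_eq_iff matrix_matrix_mult_def sum_subtractf algebra_simps)

lemma matrix_add_rdistrib:
  fixes a b c :: "'n::finite cmat"
  shows "(a + b) ** c = a ** c + b ** c"
  by (simp add: vec_eq_iff matrix_matrix_mult_def sum.distrib algebra_simps)

lemma matrix_mult_zero [simp]:
  fixes a :: "'n::finite cmat"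
  shows "0 ** a = 0" "a ** 0 = 0"
  by (simp_all add: vec_eq_iff matrix_matrix_mult_def)

lemma matrix_sum_mult:
  fixes f :: "'i \<Rightarrow> 'n::finite cmat"
  shows "(\<Sum>i\<in>I. f i) ** c = (\<Sum>i\<in>I. f i ** c)" "c ** (\<Sum>i\<in>I. f i) = (\<Sum>i\<in>I. c ** f i)"
  by (induction I rule: infinite_finite_induct; simp add: matrix_add_ldistrib matrix_add_rdistrib)+

lemmas mat_ring = matrix_diff_mult_distrib matrix_add_ldistrib matrix_add_rdistrib matrix_mul_assoc

lemma adj_mult_self_diag: "(adj x ** x) $ j $ j = complex_of_real (\<Sum>i\<in>UNIV. (cmod (x $ i $ j))\<^sup>2)"
  unfolding matrix_matrix_mult_def
  by (auto simp: complex_norm_square mult.commute simp del: of_real_power intro!: sum.cong)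

text \<open>The diagonal entries of \<open>adj x ** x\<close> are the squared norms of the columns
  of \<open>x\<close>, so two such matrices can cancel only if every column vanishes.\<close>

lemma adj_mult_self_add_eq_zero:
  assumes "adj x ** x + adj y ** y = 0"
  shows "y = 0"
proof -
  have "y $ i $ j = 0" for i j
  proof -
    have "(adj x ** x) $ j $ j + (adj y ** y) $ j $ j = 0"
      using assms by (metis vector_add_component zero_index)
    then have "(\<Sum>i\<in>UNIV. (cmod (x $ i $ j))\<^sup>2) + (\<Sum>i\<in>UNIV. (cmod (y $ i $ j))\<^sup>2) = 0"
      unfolding adj_mult_self_diag by (metis of_real_add of_real_eq_0_iff)
    moreover have "(\<Sum>i\<in>UNIV. (cmod (x $ i $ j))\<^sup>2) \<ge> 0" "(\<Sum>i\<in>UNIV. (cmod (y $ i $ j))\<^sup>2) \<ge> 0"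
      by (simp_all add: sum_nonneg)
    ultimately have "(\<Sum>i\<in>UNIV. (cmod (y $ i $ j))\<^sup>2) = 0" by linarith
    then show ?thesis by (simp add: sum_nonneg_eq_0_iff)
  qed
  then show ?thesis by (simp add: vec_eq_iff)
qed

section \<open>Projections and their order\<close>

lemma projection_adj: "projection p \<Longrightarrow> adj p = p"
  and projection_idem: "projection p \<Longrightarrow> p ** p = p"
  by (simp_all add: projection_def self_adjoint_def)

lemma projectionI: "adj p = p \<Longrightarrow> p ** p = p \<Longrightarrow> projection p"
  by (simp add: projection_def self_adjoint_def)

lemma projection_zero: "projection 0"
  and projection_one: "projection (mat 1)"
  by (auto intro!: projectionI)

lemma projection_positive: "projection p \<Longrightarrow> positive p"
  unfolding positive_def by (metis projection_adj projection_idem)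

lemma projection_absorb_commute:
  assumes "projection p" "projection q" "q ** p = p"
  shows "p ** q = p"
  using assms by (metis adj_mult projection_adj)

lemma projection_compl:
  assumes "projection p" "projection q" "q ** p = p"
  shows "projection (q - p)"
  using assms projection_absorb_commute[OF assms]
  by (auto intro!: projectionI simp: adj_diff mat_ring projection_adj projection_idem)

text \<open>Replaces the operator order by an algebraic identity. For the forward direction,
  compress \<open>q - p = adj b ** b\<close> by the complement \<open>r\<close> of \<open>q\<close>:
  a positive matrix then equals \<open>- (r ** p ** r)\<close>, which forces
  \<open>p ** r = 0\<close>.\<close>

lemma projection_le_iff:
  assumes p: "projection p" and q: "projection q"
  shows "p \<preceq> q \<longleftrightarrow> q ** p = p"
proof
  assume "q ** p = p"
  then show "p \<preceq> q"
    unfolding op_le_def by (intro projection_positive projection_compl p q)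
next
  assume "p \<preceq> q"
  then obtain b where b: "q - p = adj b ** b"
    by (auto simp: op_le_def positive_def)
  define r where "r = mat 1 - q"
  have r: "projection r"
    unfolding r_def by (rule projection_compl) (auto simp: projection_one q)
  have rq: "r ** q = 0"
    by (simp add: r_def mat_ring projection_idem[OF q])
  have "adj (b ** r) ** (b ** r) = r ** (q - p) ** r"
    by (simp add: b adj_mult projection_adj[OF r] matrix_mul_assoc)
  also have "\<dots> = 0 - r ** p ** r"
    by (simp only: matrix_diff_mult_distrib rq matrix_mult_zero)
  also have "r ** p ** r = adj (p ** r) ** (p ** r)"
    by (metis adj_mult matrix_mul_assoc p projection_adj projection_idem r)
  finally have "adj (b ** r) ** (b ** r) + adj (p ** r) ** (p ** r) = 0"
    by simp
  then have "p ** r = 0"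
    by (rule adj_mult_self_add_eq_zero)
  then have "p ** q = p"
    by (simp add: r_def mat_ring)
  then show "q ** p = p"
    by (metis adj_mult p projection_adj q)
qed

lemma projection_mult:
  assumes "projection p" "projection q" "p ** q = q ** p"
  shows "projection (p ** q)"
  using assms
  by (intro projectionI) (simp add: adj_mult projection_adj, metis matrix_mul_assoc projection_idem)

lemma projection_add:
  assumes "projection p" "projection q" "p ** q = 0"
  shows "projection (p + q)"
proof -
  have "q ** p = 0"
    using assms by (metis adj_mult adj_zero projection_adj)
  then show ?thesis
    using assms by (auto intro!: projectionI simp: adj_add mat_ring projection_adj projection_idem)
qed

text \<open>Induction on the index set: the new summand annihilates the sum so far. Over an infinite
  index set the sum is 0, again a projection.\<close>

lemma projection_sum:
  assumes "\<And>i. i \<in> I \<Longrightarrow> projection (f i)"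
    and "\<And>i j. i \<in> I \<Longrightarrow> j \<in> I \<Longrightarrow> i \<noteq> j \<Longrightarrow> f i ** f j = 0"
  shows "projection (\<Sum>i\<in>I. f i)"
  using assms
proof (induction I rule: infinite_finite_induct)
  case (insert i I)
  have "f i ** (\<Sum>j\<in>I. f j) = 0"
    unfolding matrix_sum_mult using insert by (intro sum.neutral) auto
  then show ?case
    using insert by (auto intro!: projection_add)
qed (simp_all add: projection_zero)

text \<open>Equal fixed vectors mean that each range is fixed by the other projection, so
  \<open>q ** p = p\<close> and \<open>p ** q = q\<close>; the adjoint of the first identity gives
  \<open>p ** q = p\<close>.\<close>

lemma projection_eqI:
  assumes p: "projection p" and q: "projection q"
    and fixed: "\<And>v. p *v v = v \<longleftrightarrow> q *v v = v"
  shows "p = q"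
proof -
  have "q ** p = p" "p ** q = q"
    using fixed p q
    by (simp_all add: matrix_eq flip: matrix_vector_mul_assoc)
       (metis matrix_vector_mul_assoc projection_idem)+
  then show ?thesis
    using projection_absorb_commute[OF p q] by metis
qed

lemma rank_one_projection:
  fixes w :: "complex ^ 'n::finite"
  assumes "w \<noteq> 0"
  obtains o' where "projection o'" "\<And>v. \<exists>c. o' *v v = c *s w" "o' *v w = w"
proof -
  define N :: complex where "N = (\<Sum>k\<in>UNIV. w $ k * cnj (w $ k))"
  have Nr: "N = complex_of_real (\<Sum>k\<in>UNIV. (cmod (w $ k))\<^sup>2)"
    by (simp add: N_def complex_norm_square del: of_real_power)
  have "(\<Sum>k\<in>UNIV. (cmod (w $ k))\<^sup>2) \<noteq> 0"
    using assms by (auto simp: sum_nonneg_eq_0_iff vec_eq_iff)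
  then have N: "N \<noteq> 0" "cnj N = N"
    unfolding Nr by (simp_all only: of_real_eq_0_iff complex_cnj_complex_of_real not_False_eq_True)
  \<comment> \<open>The outer product of \<open>w\<close> with its conjugate, normalised by the
    squared norm \<open>N\<close>.\<close>
  define o' :: "'n cmat" where "o' = (\<chi> i j. w $ i * cnj (w $ j) / N)"
  have act: "o' *v v = ((\<Sum>k\<in>UNIV. v $ k * cnj (w $ k)) / N) *s w" for v
    by (simp add: o'_def vec_eq_iff matrix_vector_mult_def sum_distrib_left sum_divide_distrib mult_ac)
  then have ow: "o' *v w = w"
    using N by (simp flip: N_def)
  have "o' ** o' = o'"
    unfolding matrix_eq matrix_vector_mul_assoc[symmetric]
    by (metis act ow vec.scale)
  moreover have "adj o' = o'"
    by (simp add: vec_eq_iff o'_def N(2) mult.commute)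
  ultimately show ?thesis
    using that act ow projectionI by blast
qed

text \<open>Take a projection \<open>p\<close> of maximal rank with range inside \<open>V\<close>.
  If some \<open>v\<close> in \<open>V\<close> were not fixed, the rank-one projection onto
  \<open>v - p *v v\<close> would be orthogonal to \<open>p\<close>, and adding it would raise the
  rank within \<open>V\<close>.\<close>

lemma projection_of_subspace:
  fixes V :: "(complex ^ 'n::finite) set"
  assumes V: "vec.subspace V"
  obtains p where "projection p" "\<And>v. p *v v = v \<longleftrightarrow> v \<in> V"
proof -
  define Q where "Q p \<longleftrightarrow> projection p \<and> range ((*v) p) \<subseteq> V" for p :: "'n cmat"
  have "Q 0"
    by (auto simp: Q_def projection_zero vec.subspace_0[OF V])
  moreover have "\<forall>p. Q p \<longrightarrow> vec.dim (range ((*v) p)) \<le> vec.dim V"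
    by (auto simp: Q_def intro!: vec.dim_subset)
  ultimately obtain p where p: "Q p"
    and max: "\<And>p'. Q p' \<Longrightarrow> vec.dim (range ((*v) p')) \<le> vec.dim (range ((*v) p))"
    using ex_has_greatest_nat[of Q 0 "\<lambda>p. vec.dim (range ((*v) p))" "Suc (vec.dim V)"]
    by (metis less_Suc_eq_le)
  have pp: "projection p" and pV: "\<And>v. p *v v \<in> V"
    using p by (auto simp: Q_def)
  have "p *v v = v" if "v \<in> V" for v
  proof (rule ccontr)
    assume ne: "p *v v \<noteq> v"
    define w where "w = v - p *v v"
    have w0: "w \<noteq> 0" using ne by (simp add: w_def)
    have wV: "w \<in> V"
      unfolding w_def by (intro vec.subspace_diff V that pV)
    have pw: "p *v w = 0"
      by (simp add: w_def matrix_vector_mult_diff_distrib matrix_vector_mul_assoc projection_idem[OF pp])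
    obtain o' where o': "projection o'" "\<And>v. \<exists>c. o' *v v = c *s w" "o' *v w = w"
      using rank_one_projection[OF w0] by blast
    have po: "p ** o' = 0"
      unfolding matrix_eq matrix_vector_mul_assoc[symmetric]
      using o'(2) pw by (metis matrix_vector_mult_0 vec.scale vec.scale_zero_right)
    have op: "o' ** p = 0"
      by (metis adj_mult adj_zero o'(1) po pp projection_adj)
    have "Q (p + o')"
      unfolding Q_def
    proof (intro conjI projection_add pp o' po image_subsetI)
      fix x
      obtain c where "o' *v x = c *s w" using o'(2) by blast
      then show "(p + o') *v x \<in> V"
        by (simp add: matrix_vector_mult_add_rdistrib vec.subspace_add[OF V] vec.subspace_scale[OF V] pV wV)
    qed
    moreover have "vec.dim (range ((*v) p)) < vec.dim (range ((*v) (p + o')))"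
    proof (rule vec.dim_psubset)
      have sub: "vec.subspace (range ((*v) q))" for q :: "'n cmat"
        by (intro vec.linear_subspace_image vec.subspace_UNIV) auto
      have "p *v x = (p + o') *v (p *v x)" for x
        by (simp add: matrix_vector_mul_assoc matrix_add_rdistrib projection_idem[OF pp] op)
      then have "range ((*v) p) \<subseteq> range ((*v) (p + o'))"
        by blast
      moreover have "w = (p + o') *v w"
        by (simp add: matrix_vector_mult_add_rdistrib pw o')
      then have "w \<in> range ((*v) (p + o'))"
        by (rule range_eqI)
      moreover have "w \<notin> range ((*v) p)"
        using pw w0 by (auto simp: matrix_vector_mul_assoc projection_idem[OF pp])
      ultimately show "vec.span (range ((*v) p)) \<subset> vec.span (range ((*v) (p + o')))"
        using sub by (metis psubsetI vec.span_eq_iff)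
    qed
    ultimately show False
      using max not_less by blast
  qed
  then show ?thesis
    using that pp pV by metis
qed

text \<open>Invariance of the range under the adjoint makes it reducing, not merely invariant.\<close>

lemma projection_commute_invariant:
  assumes p: "projection p"
    and b: "\<And>v. p *v v = v \<Longrightarrow> p *v (b *v v) = b *v v"
    and b': "\<And>v. p *v v = v \<Longrightarrow> p *v (adj b *v v) = adj b *v v"
  shows "p ** b = b ** p"
proof -
  have "p *v (p *v v) = p *v v" for v
    by (simp add: matrix_vector_mul_assoc projection_idem[OF p])
  then have "p ** (b ** p) = b ** p" "p ** (adj b ** p) = adj b ** p"
    unfolding matrix_eq matrix_vector_mul_assoc[symmetric] using b b' by blast+
  \<comment> \<open>The adjoint of the second identity reads \<open>p ** b ** p = p ** b\<close>, to
    be compared with the first.\<close>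
  then show ?thesis
    by (metis adj_adj adj_mult matrix_mul_assoc p projection_adj)
qed

section \<open>Eigenspaces, spectral projections and eigenvectors\<close>

lemma vec_subspace_eigenspace: "vec.subspace {v. a *v v = t *s v}"
  for a :: "'n::finite cmat"
  by (auto intro!: vec.subspaceI simp: vec.add vec.scale vec.scale_right_distrib mult.commute)

text \<open>Justifies the definite description: the eigenspace is a subspace, so a projection onto
  it exists, and its fixed vectors determine it.\<close>

lemma eigenprojection:
  fixes a :: "'n::finite cmat"
  shows "projection (eigenprojection a t) \<and>
    (\<forall>v. eigenprojection a t *v v = v \<longleftrightarrow> a *v v = complex_of_real t *s v)"
  unfolding eigenprojection_def
proof (rule theI')
  obtain p where "projection p" "\<And>v. p *v v = v \<longleftrightarrow> v \<in> {v. a *v v = complex_of_real t *s v}"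
    using projection_of_subspace[OF vec_subspace_eigenspace] by blast
  then show "\<exists>!p. projection p \<and> (\<forall>v. p *v v = v \<longleftrightarrow> a *v v = complex_of_real t *s v)"
    by (intro ex1I[of _ p] conjI) (auto intro: projection_eqI)
qed

lemma mult_eigenprojection: "a ** eigenprojection a t = cscale (complex_of_real t) (eigenprojection a t)"
  unfolding matrix_eq matrix_vector_mul_assoc[symmetric] cscale_vec
  using eigenprojection[of a t] by (metis matrix_vector_mul_assoc projection_idem)

text \<open>Eigenprojections for \<open>s \<noteq> t\<close> annihilate each other: evaluating
  \<open>?s ** a ** ?t\<close> from the left and from the right gives \<open>s\<close> and
  \<open>t\<close> times the same product. Self-adjointness lets \<open>a\<close> act on
  \<open>?s\<close> from the right.\<close>

lemma spectral_projection_projection: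
  assumes a: "self_adjoint a"
  shows "projection (spectral_projection \<Delta> a)"
  unfolding spectral_projection_def
proof (rule projection_sum)
  show "projection (eigenprojection a t)" for t
    using eigenprojection by blast
  fix s t :: real
  assume "s \<noteq> t"
  let ?s = "eigenprojection a s" and ?t = "eigenprojection a t"
  have "?s ** a = cscale (complex_of_real s) ?s"
    using arg_cong[OF mult_eigenprojection[of a s], of adj] a eigenprojection[of a s]
    by (simp add: adj_mult self_adjoint_def adj_cscale projection_adj)
  then have "cscale (complex_of_real s) (?s ** ?t) = cscale (complex_of_real t) (?s ** ?t)"
    by (metis cscale_mult_left cscale_mult_right matrix_mul_assoc mult_eigenprojection)
  then show "?s ** ?t = 0"
    using \<open>s \<noteq> t\<close> by (auto simp: vec_eq_iff)
qed

text \<open>Take a nonzero polynomial \<open>q\<close> of least degree with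
  \<open>q(a) v = 0\<close>. A root \<open>t\<close> splits off a linear factor, and the cofactor
  \<open>r\<close> yields the eigenvector \<open>r(a) v\<close>, nonzero by minimality. It lies in
  \<open>S\<close> because all iterates of \<open>v\<close> under \<open>a\<close> do.\<close>

lemma exists_eigenvector:
  fixes a :: "'n::finite cmat" and S :: "(complex ^ 'n) set"
  assumes S: "vec.subspace S" and inv: "\<And>v. v \<in> S \<Longrightarrow> a *v v \<in> S" and v: "v \<in> S" "v \<noteq> 0"
  obtains t w where "w \<in> S" "w \<noteq> 0" "a *v w = t *s w"
proof -
  define x where "x i = (((*v) a) ^^ i) v" for i
  have xS: "x i \<in> S" for i
    by (induction i) (auto simp: x_def v inv)
  have x_Suc: "a *v x i = x (Suc i)" for i
    by (simp add: x_def)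
  \<comment> \<open>\<open>act q\<close> is the vector \<open>q(a) v\<close>. The next fact pads the
    sum with zero coefficients, so that polynomials of different degree can be compared.\<close>
  define act where "act q = (\<Sum>i\<le>degree q. coeff q i *s x i)" for q :: "complex poly"
  have act: "act q = (\<Sum>i\<le>N. coeff q i *s x i)" if "degree q \<le> N" for q N
    unfolding act_def using that
    by (intro sum.mono_neutral_left) (auto simp: coeff_eq_0)
  have actS: "act q \<in> S" for q
    unfolding act_def by (intro vec.subspace_sum vec.subspace_scale S xS)
  have act_root: "act ([:-t, 1:] * q) = a *v act q - t *s act q" for t q
  proof -
    have deg: "degree ([:-t, 1:] * q) \<le> Suc (degree q)"
      by (rule order_trans[OF degree_mult_le]) simp
    have c: "coeff ([:-t, 1:] * q) i = coeff (pCons 0 q) i - t * coeff q i" for i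
      by simp
    have "act ([:-t, 1:] * q) = (\<Sum>i\<le>Suc (degree q). coeff (pCons 0 q) i *s x i)
        - (\<Sum>i\<le>Suc (degree q). (t * coeff q i) *s x i)"
      unfolding act[OF deg] c by (simp add: vec.scale_left_diff_distrib sum_subtractf del: sum.atMost_Suc)
    also have "(\<Sum>i\<le>Suc (degree q). coeff (pCons 0 q) i *s x i) = (\<Sum>i\<le>degree q. coeff q i *s x (Suc i))"
      by (subst sum.atMost_Suc_shift) simp
    also have "\<dots> = a *v act q"
      by (simp add: act_def vec.sum vec.scale x_Suc)
    also have "(\<Sum>i\<le>Suc (degree q). (t * coeff q i) *s x i) = t *s act q"
      by (simp add: act[of q "Suc (degree q)"] vec.scale_sum_right del: sum.atMost_Suc)
    finally show ?thesis .
  qed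
  \<comment> \<open>Among the first \<open>CARD('n) + 1\<close> iterates, either two coincide,
    giving the difference of two monomials, or they form a set too large to be independent. The
    split is needed because linear dependence is a property of sets, which forget
    repetitions.\<close>
  have "\<exists>q. q \<noteq> 0 \<and> act q = 0"
  proof (cases "inj_on x {..CARD('n)}")
    case False
    then obtain i j where ij: "i < j" "x i = x j"
      by (metis (no_types, lifting) inj_onI linorder_neqE_nat)
    define q :: "complex poly" where "q = monom 1 i - monom 1 j"
    have "coeff q i = 1"
      using ij by (simp add: q_def)
    moreover have "degree q \<le> j"
      unfolding q_def using ij by (intro degree_diff_le) (auto simp: degree_monom_eq)
    then have "act q = (\<Sum>k\<le>j. (if k = i then x k else 0) - (if k = j then x k else 0))"
      unfolding act[OF \<open>degree q \<le> j\<close>] using ij by (intro sum.cong) (auto simp: q_def)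
    then have "act q = 0"
      using ij by (simp add: sum_subtractf)
    ultimately show ?thesis
      by (intro exI[of _ q]) auto
  next
    case True
    let ?X = "x ` {..CARD('n)}"
    have "card ?X > vec.dim ?X"
      using True vec.dim_subset_UNIV[of ?X] by (simp add: card_image card_cart_basis vec.dimension_def)
    then have "vec.dependent ?X"
      using vec.dependent_biggerset_general by blast
    then obtain u where u: "\<exists>y\<in>?X. u y \<noteq> 0" "(\<Sum>y\<in>?X. u y *s y) = 0"
      using vec.dependent_finite[of ?X] by auto
    define q where "q = (\<Sum>i\<le>CARD('n). monom (u (x i)) i)"
    have coeff: "coeff q i = (if i \<le> CARD('n) then u (x i) else 0)" for i
      by (simp add: q_def coeff_sum)
    have "q \<noteq> 0"
    proof
      assume "q = 0"
      then have "u (x i) = 0" if "i \<le> CARD('n)" for i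
        using coeff[of i] that by simp
      then show False
        using u(1) by auto
    qed
    moreover have "degree q \<le> CARD('n)"
      by (rule degree_le) (simp add: coeff)
    then have "act q = 0"
      using u(2) True by (simp add: act coeff sum.reindex)
    ultimately show ?thesis by blast
  qed
  then obtain q where q: "q \<noteq> 0" "act q = 0"
    and min: "\<And>q'. q' \<noteq> 0 \<Longrightarrow> act q' = 0 \<Longrightarrow> degree q \<le> degree q'"
    using ex_has_least_nat[of "\<lambda>q. q \<noteq> 0 \<and> act q = 0" _ degree] by metis
  \<comment> \<open>A nonzero constant cannot annihilate \<open>v\<close>, so \<open>q\<close> has a
    root.\<close>
  have "degree q \<noteq> 0"
  proof
    assume "degree q = 0"
    then have "coeff q 0 *s v = 0"
      using q(2) by (simp add: act_def x_def)
    moreover have "coeff q 0 \<noteq> 0"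
      using q(1) \<open>degree q = 0\<close> by (metis leading_coeff_0_iff)
    ultimately show False using v by (simp add: vec.scale_eq_0_iff)
  qed
  then obtain t where "poly q t = 0"
    using fundamental_theorem_of_algebra[of q] constant_degree[of q] by auto
  then obtain r where r: "q = [:-t, 1:] * r"
    by (auto simp: poly_eq_0_iff_dvd elim: dvdE)
  have "r \<noteq> 0" using q r by auto
  then have "degree q = Suc (degree r)"
    unfolding r by (subst degree_mult_eq) auto
  then have "act r \<noteq> 0"
    using min[of r] \<open>r \<noteq> 0\<close> by auto
  moreover have "a *v act r = t *s act r"
    using act_root[of t r] q(2) r by simp
  ultimately show ?thesis
    using that actS by blast
qed

section \<open>Minimal projections of a context\<close>

lemma
  assumes "C \<in> contexts"
  shows context_one: "mat 1 \<in> C"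
    and context_add: "a \<in> C \<Longrightarrow> b \<in> C \<Longrightarrow> a + b \<in> C"
    and context_mult: "a \<in> C \<Longrightarrow> b \<in> C \<Longrightarrow> a ** b \<in> C"
    and context_cscale: "a \<in> C \<Longrightarrow> cscale z a \<in> C"
    and context_adj: "a \<in> C \<Longrightarrow> adj a \<in> C"
    and context_bicommutant: "commutant (commutant C) = C"
    and context_commute: "a \<in> C \<Longrightarrow> b \<in> C \<Longrightarrow> a ** b = b ** a"
  using assms by (auto simp: contexts_def von_neumann_subalgebra_def)

lemma context_zero: "C \<in> contexts \<Longrightarrow> 0 \<in> C"
  by (metis context_cscale context_one cscale_zero)

lemma context_diff: "C \<in> contexts \<Longrightarrow> a \<in> C \<Longrightarrow> b \<in> C \<Longrightarrow> a - b \<in> C"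
  by (metis add_uminus_conv_diff context_add context_cscale cscale_minus_one)

lemma context_sum: "C \<in> contexts \<Longrightarrow> (\<And>i. i \<in> I \<Longrightarrow> f i \<in> C) \<Longrightarrow> (\<Sum>i\<in>I. f i) \<in> C"
  by (induction I rule: infinite_finite_induct) (auto simp: context_zero context_add)

lemma ProjD: "p \<in> Proj C \<Longrightarrow> p \<in> C" "p \<in> Proj C \<Longrightarrow> projection p"
  by (auto simp: Proj_def)

lemma ProjI: "p \<in> C \<Longrightarrow> projection p \<Longrightarrow> p \<in> Proj C"
  by (auto simp: Proj_def)

lemma Proj_mono: "D \<subseteq> C \<Longrightarrow> Proj D \<subseteq> Proj C"
  by (auto simp: Proj_def)

lemma Proj_mult:
  assumes "C \<in> contexts" "p \<in> Proj C" "q \<in> Proj C"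
  shows "p ** q \<in> Proj C"
  using assms by (auto simp: Proj_def context_mult intro: projection_mult context_commute)

lemma Proj_compl:
  assumes "C \<in> contexts" "p \<in> Proj C"
  shows "mat 1 - p \<in> Proj C"
  using assms by (auto simp: Proj_def context_diff context_one projection_one intro: projection_compl)

text \<open>The join of commuting projections in De Morgan form, that is
  \<open>p + q - p ** q\<close>. Built from complements and a product, it stays in a context and is
  easy to evaluate under a character.\<close>

definition sup_proj :: "'n::finite cmat \<Rightarrow> 'n cmat \<Rightarrow> 'n cmat" where
  "sup_proj p q = mat 1 - (mat 1 - p) ** (mat 1 - q)"

lemma sup_proj_Proj: "C \<in> contexts \<Longrightarrow> p \<in> Proj C \<Longrightarrow> q \<in> Proj C \<Longrightarrow> sup_proj p q \<in> Proj C"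
  unfolding sup_proj_def by (intro Proj_compl Proj_mult)

lemma sup_proj_upper:
  assumes C: "C \<in> contexts" and p: "p \<in> Proj C" and q: "q \<in> Proj C"
  shows "sup_proj p q ** p = p" "sup_proj p q ** q = q"
proof -
  have comm: "q ** p = p ** q" using C p q by (meson context_commute ProjD)
  have pqp: "p ** q ** p = p ** q"
    by (metis ProjD(2) comm matrix_mul_assoc p projection_idem)
  have pqq: "p ** q ** q = p ** q"
    by (metis ProjD(2) matrix_mul_assoc projection_idem q)
  show "sup_proj p q ** p = p" "sup_proj p q ** q = q"
    using p q by (simp_all add: sup_proj_def mat_ring comm pqp pqq ProjD projection_idem)
qed

lemma sup_proj_least:
  assumes "r ** p = p" "r ** q = q"
  shows "r ** sup_proj p q = sup_proj p q"
  using assms by (simp add: sup_proj_def mat_ring)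

text \<open>Since the context equals its bicommutant, it suffices to commute with the commutant.\<close>

lemma projection_in_context:
  assumes C: "C \<in> contexts" and p: "projection p"
    and inv: "\<And>b v. b \<in> commutant C \<Longrightarrow> p *v v = v \<Longrightarrow> p *v (b *v v) = b *v v"
  shows "p \<in> C"
proof -
  \<comment> \<open>The context is closed under adjoints, hence so is its commutant; the invariance
    hypothesis therefore applies to \<open>adj b\<close> as well.\<close>
  have adj: "adj b \<in> commutant C" if "b \<in> commutant C" for b
    unfolding commutant_def
  proof safe
    fix a
    assume "a \<in> C"
    then have "adj a ** b = b ** adj a"
      using that context_adj[OF C] by (auto simp: commutant_def)
    from arg_cong[OF this, of adj] show "a ** adj b = adj b ** a"
      by (simp add: adj_mult)
  qed
  have "p ** b = b ** p" if "b \<in> commutant C" for b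
    using p by (rule projection_commute_invariant) (use that adj inv in auto)
  then have "p \<in> commutant (commutant C)"
    by (simp add: commutant_def[of "commutant C"])
  then show ?thesis
    using context_bicommutant[OF C] by simp
qed

text \<open>Makes rank a measure for choosing minimal projections. If the ranges agreed,
  \<open>f\<close> would fix the range of \<open>e\<close>, giving \<open>f ** e = e\<close>, while
  \<open>f ** e = f\<close> by taking adjoints.\<close>

lemma projection_rank_less:
  fixes e f :: "'n::finite cmat"
  assumes f: "projection f" and e: "projection e" and ef: "e ** f = f" and ne: "f \<noteq> e"
  shows "vec.dim (range ((*v) f)) < vec.dim (range ((*v) e))"
proof (rule vec.dim_psubset)
  have sub: "vec.subspace (range ((*v) q))" for q :: "'n cmat"
    by (intro vec.linear_subspace_image vec.subspace_UNIV) auto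
  have "f *v x = e *v (f *v x)" for x
    by (simp add: matrix_vector_mul_assoc ef)
  then have le: "range ((*v) f) \<subseteq> range ((*v) e)"
    by blast
  have "range ((*v) f) \<noteq> range ((*v) e)"
  proof
    assume eq: "range ((*v) f) = range ((*v) e)"
    have "f *v (e *v x) = e *v x" for x
    proof -
      obtain y where "e *v x = f *v y"
        using eq by (metis rangeE rangeI)
      then show ?thesis
        by (simp add: matrix_vector_mul_assoc projection_idem[OF f])
    qed
    then have "f ** e = e"
      by (simp add: matrix_eq flip: matrix_vector_mul_assoc)
    then show False
      using projection_absorb_commute[OF f e ef] ne by simp
  qed
  then show "vec.span (range ((*v) f)) \<subset> vec.span (range ((*v) e))"
    using le sub by (metis psubsetI vec.span_eq_iff)
qed

text \<open>The projections of \<open>D\<close> above \<open>P\<close> are closed under products, so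
  one of least rank, \<open>m\<close>, is the least of them: otherwise \<open>q ** m\<close> would
  be a member of smaller rank.\<close>

lemma outer_daseinisation:
  assumes D: "D \<in> contexts" and P: "projection P"
  shows "outer_daseinisation P D \<in> Proj D"
    and "outer_daseinisation P D ** P = P"
    and "\<And>q. q \<in> Proj D \<Longrightarrow> q ** P = P \<Longrightarrow> q ** outer_daseinisation P D = outer_daseinisation P D"
proof -
  define S where "S = {q \<in> Proj D. P \<preceq> q}"
  have S: "q \<in> S \<longleftrightarrow> q \<in> Proj D \<and> q ** P = P" for q
    using projection_le_iff[OF P] by (auto simp: S_def ProjD)
  have "mat 1 \<in> S"
    by (simp add: S ProjI context_one D projection_one)
  then obtain m where m: "m \<in> S"
    and min: "\<And>q. q \<in> S \<Longrightarrow> vec.dim (range ((*v) m)) \<le> vec.dim (range ((*v) q))"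
    using ex_has_least_nat[of "\<lambda>q. q \<in> S" _ "\<lambda>q. vec.dim (range ((*v) q))"] by metis
  have least: "q ** m = m" if q: "q \<in> S" for q
  proof (rule ccontr)
    assume ne: "q ** m \<noteq> m"
    have qm: "q ** m \<in> S"
      using q m by (auto simp: S Proj_mult D simp flip: matrix_mul_assoc)
    have "m ** (q ** m) = q ** m"
      using q m D by (metis S ProjD context_commute matrix_mul_assoc projection_idem)
    then have "vec.dim (range ((*v) (q ** m))) < vec.dim (range ((*v) m))"
      using qm m ne by (intro projection_rank_less) (auto simp: S ProjD)
    then show False
      using min[OF qm] by simp
  qed
  let ?L = "Proj_lattice D"
  have "greatest ?L m (Lower ?L S)"
    unfolding greatest_def Lower_def using m least
    by (auto simp: Proj_lattice_def S projection_le_iff ProjD)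
  \<comment> \<open>The lattice infimum is a choice operator, so \<open>m\<close> must be shown to
    be the only greatest lower bound.\<close>
  moreover have "g = m" if "greatest ?L g (Lower ?L S)" for g
  proof -
    have g: "g \<in> Lower ?L S" and "\<forall>x\<in>Lower ?L S. x \<preceq> g"
      using that by (auto simp: greatest_def Proj_lattice_def)
    moreover have "m \<in> Lower ?L S"
      using \<open>greatest ?L m (Lower ?L S)\<close> by (simp add: greatest_def)
    ultimately have "m \<preceq> g" by blast
    have gP: "g \<in> Proj D" and "g \<preceq> m"
      using g m by (auto simp: Lower_def Proj_lattice_def S)
    have "projection g" "projection m"
      using gP m by (auto simp: S ProjD)
    then show "g = m"
      using \<open>g \<preceq> m\<close> \<open>m \<preceq> g\<close> by (metis projection_absorb_commute projection_le_iff)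
  qed
  ultimately have "outer_daseinisation P D = m"
    unfolding outer_daseinisation_def Lattice.inf_def S_def[symmetric] by (rule some_equality)
  then show "outer_daseinisation P D \<in> Proj D" "outer_daseinisation P D ** P = P"
    "\<And>q. q \<in> Proj D \<Longrightarrow> q ** P = P \<Longrightarrow> q ** outer_daseinisation P D = outer_daseinisation P D"
    using m least by (auto simp: S)
qed

section \<open>The minimal projections as a partition of unity\<close>

definition atoms :: "'n::finite cmat set \<Rightarrow> 'n cmat set" where
  "atoms C = {e \<in> Proj C. e \<noteq> 0 \<and> (\<forall>f\<in>Proj C. e ** f = f \<longrightarrow> f = 0 \<or> f = e)}"

lemma atomsD:
  assumes "e \<in> atoms C"
  shows "e \<in> Proj C" "e \<in> C" "projection e" "e \<noteq> 0"
    and "f \<in> Proj C \<Longrightarrow> e ** f = f \<Longrightarrow> f = 0 \<or> f = e"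
  using assms by (auto simp: atoms_def Proj_def)

lemma exists_atom_below:
  assumes C: "C \<in> contexts" and p: "p \<in> Proj C" "p \<noteq> 0"
  obtains e where "e \<in> atoms C" "p ** e = e"
proof -
  let ?Q = "\<lambda>e. e \<in> Proj C \<and> e \<noteq> 0 \<and> p ** e = e"
  have "?Q p" using p by (simp add: ProjD projection_idem)
  then obtain e where e: "?Q e"
    and min: "\<And>f. ?Q f \<Longrightarrow> vec.dim (range ((*v) e)) \<le> vec.dim (range ((*v) f))"
    using ex_has_least_nat[of ?Q _ "\<lambda>q. vec.dim (range ((*v) q))"] by metis
  have "f = 0 \<or> f = e" if f: "f \<in> Proj C" "e ** f = f" for f
  proof (rule ccontr)
    assume ne: "\<not> (f = 0 \<or> f = e)"
    have "p ** f = f"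
      using e f(2) by (metis matrix_mul_assoc)
    then show False
      using projection_rank_less[of f e] min[of f] f e ne by (auto simp: Proj_def)
  qed
  then show ?thesis
    using that e by (auto simp: atoms_def)
qed

text \<open>The product lies below both atoms; were it nonzero, it would equal each of them.\<close>

lemma atoms_orthogonal:
  assumes C: "C \<in> contexts" and e: "e \<in> atoms C" and f: "f \<in> atoms C" and "e \<noteq> f"
  shows "e ** f = 0"
proof -
  have "e ** f \<in> Proj C"
    using C e f by (intro Proj_mult) (auto simp: atomsD)
  moreover have "e ** (e ** f) = e ** f"
    using e by (simp add: matrix_mul_assoc atomsD projection_idem)
  moreover have "f ** (e ** f) = e ** f"
    using C e f by (metis atomsD(2,3) context_commute matrix_mul_assoc projection_idem)
  ultimately show ?thesis
    using atomsD(5)[OF e, of "e ** f"] atomsD(5)[OF f, of "e ** f"] \<open>e \<noteq> f\<close> by auto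
qed

text \<open>Atoms are linearly independent over the reals: multiplying a linear relation by one atom
  isolates its coefficient. An independent set of matrices is finite.\<close>

lemma finite_atoms:
  assumes C: "C \<in> contexts"
  shows "finite (atoms C)"
proof (rule independent_imp_finite, rule notI)
  assume "dependent (atoms C)"
  then obtain t u e where t: "finite t" "t \<subseteq> atoms C" "(\<Sum>v\<in>t. u v *\<^sub>R v) = 0" "e \<in> t" "u e \<noteq> 0"
    unfolding dependent_explicit by blast
  have "0 = (\<Sum>v\<in>t. u v *\<^sub>R v) ** e"
    by (simp add: t)
  also have "\<dots> = (\<Sum>v\<in>t. u v *\<^sub>R (v ** e))"
    unfolding matrix_sum_mult
    by (intro sum.cong) (auto simp: vec_eq_iff matrix_matrix_mult_def scaleR_sum_right)
  also have "\<dots> = (\<Sum>v\<in>t. if v = e then u e *\<^sub>R e else 0)"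
    using t by (intro sum.cong) (auto simp: atoms_orthogonal[OF C] atomsD projection_idem subset_iff)
  also have "\<dots> = u e *\<^sub>R e"
    using t by simp
  finally show False
    using t atomsD(4)[of e C] by auto
qed

text \<open>Otherwise some atom \<open>e\<close> lies below the complement of the sum
  \<open>s\<close>; but \<open>s ** e = e\<close> by orthogonality, so \<open>e = 0\<close>.\<close>

lemma sum_atoms:
  assumes C: "C \<in> contexts"
  shows "(\<Sum>e\<in>atoms C. e) = mat 1"
proof (rule ccontr)
  define s where "s = (\<Sum>e\<in>atoms C. e)"
  assume "(\<Sum>e\<in>atoms C. e) \<noteq> mat 1"
  then have ne: "mat 1 - s \<noteq> 0" by (simp add: s_def)
  have "s \<in> Proj C"
    unfolding s_def by (intro ProjI context_sum projection_sum) (auto simp: C atomsD atoms_orthogonal[OF C])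
  then obtain e where e: "e \<in> atoms C" "(mat 1 - s) ** e = e"
    using exists_atom_below[OF C _ ne] Proj_compl[OF C] by blast
  have "s ** e = (\<Sum>f\<in>atoms C. if f = e then e else 0)"
    unfolding s_def matrix_sum_mult using e
    by (intro sum.cong) (auto simp: atoms_orthogonal[OF C] atomsD projection_idem)
  also have "\<dots> = e"
    using e finite_atoms[OF C] by simp
  finally show False
    using e atomsD(4)[of e C] by (simp add: mat_ring)
qed

text \<open>A minimal projection \<open>e\<close> lies below any eigenprojection of \<open>a\<close> that it meets, because the joint
  eigenspace inside the range of \<open>e\<close> is invariant under the commutant.\<close>

lemma atom_scalar:
  assumes C: "C \<in> contexts" and e: "e \<in> atoms C" and a: "a \<in> C"
  shows "\<exists>t. a ** e = cscale t e"
proof -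
  have ae: "a ** e = e ** a"
    using C a e by (metis atomsD(2) context_commute)
  have ee: "e ** e = e"
    using e by (simp add: atomsD projection_idem)
  \<comment> \<open>The range of \<open>e\<close>, written as its eigenspace for the eigenvalue 1 so
    that the subspace lemma applies.\<close>
  let ?S = "{v. e *v v = 1 *s v}"
  obtain v where ne: "e *v v \<noteq> 0"
    using atomsD(4)[OF e] by (metis matrix_eq matrix_vector_mult_0)
  have ev: "e *v v \<in> ?S"
    by (simp add: matrix_vector_mul_assoc ee)
  have inv: "a *v u \<in> ?S" if "u \<in> ?S" for u
  proof -
    have "e *v (a *v u) = a *v (e *v u)"
      by (simp add: matrix_vector_mul_assoc ae)
    then show ?thesis using that by simp
  qed
  obtain t w where w: "w \<in> ?S" "w \<noteq> 0" "a *v w = t *s w"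
    by (rule exists_eigenvector[OF vec_subspace_eigenspace inv ev ne])
  obtain f where f: "projection f" "\<And>v. f *v v = v \<longleftrightarrow> v \<in> ?S \<inter> {v. a *v v = t *s v}"
    using projection_of_subspace[OF vec.subspace_inter
        [OF vec_subspace_eigenspace[of e 1] vec_subspace_eigenspace[of a t]]] by blast
  have ff: "f *v (f *v v) = f *v v" for v
    by (simp add: matrix_vector_mul_assoc projection_idem f(1))
  have "f \<in> C"
  proof (rule projection_in_context[OF C f(1)])
    fix b v
    assume b: "b \<in> commutant C" and "f *v v = v"
    then have v: "e *v v = v" "a *v v = t *s v"
      by (simp_all add: f(2))
    have "e ** b = b ** e" "a ** b = b ** a"
      using b a e by (auto simp: commutant_def atomsD)
    then have "e *v (b *v v) = b *v v" "a *v (b *v v) = t *s (b *v v)"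
      by (metis matrix_vector_mul_assoc v(1), metis matrix_vector_mul_assoc v(2) vec.scale)
    then show "f *v (b *v v) = b *v v"
      by (simp add: f(2))
  qed
  moreover have "e ** f = f"
    using f(2) ff by (simp add: matrix_eq flip: matrix_vector_mul_assoc)
  moreover have "f \<noteq> 0"
    using w f(2)[of w] by auto
  ultimately have "f = e"
    using atomsD(5)[OF e, of f] f(1) by (auto simp: ProjI)
  have "a *v (f *v x) = t *s (f *v x)" for x
    using f(2)[of "f *v x"] ff by simp
  then have "a ** e = cscale t e"
    unfolding matrix_eq \<open>f = e\<close> by (simp add: cscale_vec flip: matrix_vector_mul_assoc)
  then show ?thesis ..
qed

section \<open>The spectrum and the Riesz-Markov measure\<close>

definition atom_value :: "'n::finite cmat \<Rightarrow> 'n cmat \<Rightarrow> complex" where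
  "atom_value e a = (THE t. a ** e = cscale t e)"

lemma cscale_cancel: "e \<noteq> 0 \<Longrightarrow> cscale s e = cscale t e \<longleftrightarrow> s = t"
  by (auto simp: vec_eq_iff)

lemma atom_value_eqI: "e \<noteq> 0 \<Longrightarrow> a ** e = cscale t e \<Longrightarrow> atom_value e a = t"
  by (auto simp: atom_value_def cscale_cancel intro!: the_equality)

lemma mult_atom:
  assumes "C \<in> contexts" "e \<in> atoms C" "a \<in> C"
  shows "a ** e = cscale (atom_value e a) e"
  using atom_scalar[OF assms] atom_value_eqI[of e a] atomsD(4)[OF assms(2)] by metis

lemma atom_value_atom:
  assumes C: "C \<in> contexts" and e: "e \<in> atoms C" and f: "f \<in> atoms C"
  shows "atom_value e f = of_bool (e = f)"
  using e f by (intro atom_value_eqI) (auto simp: atomsD projection_idem atoms_orthogonal[OF C])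

lemma charactersD:
  assumes "l \<in> characters C"
  shows "l \<in> extensional C"
    and "a \<in> C \<Longrightarrow> b \<in> C \<Longrightarrow> l (a + b) = l a + l b"
    and "a \<in> C \<Longrightarrow> l (cscale z a) = z * l a"
    and "a \<in> C \<Longrightarrow> b \<in> C \<Longrightarrow> l (a ** b) = l a * l b"
    and "l (mat 1) = 1"
  using assms by (auto simp: characters_def clinear_on_def)

lemma character_sum:
  assumes C: "C \<in> contexts" and l: "l \<in> characters C" and f: "\<And>i. i \<in> I \<Longrightarrow> f i \<in> C"
  shows "l (\<Sum>i\<in>I. f i) = (\<Sum>i\<in>I. l (f i))"
proof -
  have "l 0 = 0"
    using charactersD(3)[OF l context_one[OF C], of 0] by simp
  then show ?thesis
    using f by (induction I rule: infinite_finite_induct)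
      (auto simp: charactersD(2)[OF l] context_sum[OF C])
qed

lemma character_diff:
  assumes C: "C \<in> contexts" and l: "l \<in> characters C" and "a \<in> C" "b \<in> C"
  shows "l (a - b) = l a - l b"
  using charactersD(2)[OF l, of "a - b" b] assms by (simp add: context_diff)

lemma character_Proj:
  assumes "l \<in> characters C" "p \<in> Proj C"
  shows "l p = 0 \<or> l p = 1"
  using charactersD(4)[OF assms(1), of p p] assms(2) by (simp add: ProjD projection_idem)

definition atom_character :: "'n::finite cmat set \<Rightarrow> 'n cmat \<Rightarrow> 'n cmat \<Rightarrow> complex" where
  "atom_character C e = restrict (atom_value e) C"

lemma atom_character_character:
  assumes C: "C \<in> contexts" and e: "e \<in> atoms C"
  shows "atom_character C e \<in> characters C"
proof -
  note e0 = atomsD(4)[OF e] and m = mult_atom[OF C e]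
  have "atom_value e (a + b) = atom_value e a + atom_value e b" if "a \<in> C" "b \<in> C" for a b
    using e0 by (rule atom_value_eqI)
      (simp add: matrix_add_rdistrib m that, simp add: vec_eq_iff distrib_right)
  moreover have "atom_value e (cscale z a) = z * atom_value e a" if "a \<in> C" for z a
    using e0 by (rule atom_value_eqI)
      (simp add: cscale_mult_left m that, simp add: vec_eq_iff mult.assoc)
  moreover have "atom_value e (a ** b) = atom_value e a * atom_value e b" if "a \<in> C" "b \<in> C" for a b
    using e0
  proof (rule atom_value_eqI)
    have "a ** b ** e = cscale (atom_value e b) (a ** e)"
      by (simp add: m that cscale_mult_right flip: matrix_mul_assoc)
    also have "\<dots> = cscale (atom_value e a * atom_value e b) e"
      by (simp add: m that, simp add: vec_eq_iff mult_ac)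
    finally show "a ** b ** e = cscale (atom_value e a * atom_value e b) e" .
  qed
  moreover have "atom_value e (mat 1) = 1"
    using e0 by (rule atom_value_eqI) simp
  ultimately show ?thesis
    using C by (auto simp: atom_character_def characters_def clinear_on_def
        context_add context_cscale context_mult context_one)
qed

lemma atom_character_atom:
  assumes "C \<in> contexts" "e \<in> atoms C" "f \<in> atoms C"
  shows "atom_character C e f = of_bool (e = f)"
  using assms by (simp add: atom_character_def atom_value_atom atomsD)

lemma inj_on_atom_character:
  assumes "C \<in> contexts"
  shows "inj_on (atom_character C) (atoms C)"
proof (rule inj_onI)
  fix e f
  assume ef: "e \<in> atoms C" "f \<in> atoms C" and "atom_character C e = atom_character C f"
  then have "atom_character C e e = atom_character C f e" by simp
  then show "e = f"
    using ef by (simp add: atom_character_atom assms split: if_splits)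
qed

text \<open>The values of a character \<open>l\<close> on the atoms add up to 1, so
  \<open>l e \<noteq> 0\<close> for some atom \<open>e\<close>. Applying \<open>l\<close> to
  \<open>a ** e = cscale t e\<close> and cancelling \<open>l e\<close> gives
  \<open>l a = t\<close>.\<close>

lemma characters_eq:
  assumes C: "C \<in> contexts"
  shows "characters C = atom_character C ` atoms C"
proof (intro equalityI subsetI)
  fix l
  assume l: "l \<in> characters C"
  have "(\<Sum>e\<in>atoms C. l e) = 1"
    using character_sum[OF C l, of "atoms C" "\<lambda>e. e"] sum_atoms[OF C] charactersD(5)[OF l]
    by (simp add: atomsD)
  then obtain e where e: "e \<in> atoms C" "l e \<noteq> 0"
    by (metis sum.neutral zero_neq_one)
  have "l a = atom_value e a" if "a \<in> C" for a
  proof -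
    have "l a * l e = atom_value e a * l e"
      using charactersD(3,4)[OF l] mult_atom[OF C e(1) that] that e(1) by (metis atomsD(2))
    then show ?thesis using e by simp
  qed
  then have "l = atom_character C e"
    unfolding atom_character_def using charactersD(1)[OF l]
    by (intro extensionalityI) auto
  then show "l \<in> atom_character C ` atoms C"
    using e by blast
qed (use atom_character_character[OF C] in auto)

lemma finite_characters: "C \<in> contexts \<Longrightarrow> finite (characters C)"
  by (simp add: characters_eq finite_atoms)

lemma topspace_gelfand_spectrum: "topspace (gelfand_spectrum C) = characters C"
  by (auto simp: gelfand_spectrum_def PiE_def characters_def)

text \<open>The spectrum is discrete: evaluation at an atom is continuous and is nonzero at exactly
  one character.\<close>

lemma openin_gelfand_spectrum:
  assumes C: "C \<in> contexts"
  shows "openin (gelfand_spectrum C) U \<longleftrightarrow> U \<subseteq> characters C"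
proof
  assume U: "U \<subseteq> characters C"
  have "openin (gelfand_spectrum C) {l}" if l: "l \<in> characters C" for l
  proof -
    obtain e where e: "e \<in> atoms C" "l = atom_character C e"
      using l unfolding characters_eq[OF C] by blast
    have "continuous_map (gelfand_spectrum C) euclidean (\<lambda>l. l e)"
      unfolding gelfand_spectrum_def using e
      by (intro continuous_map_from_subtopology continuous_map_product_projection) (simp add: atomsD)
    then have "openin (gelfand_spectrum C) {m \<in> topspace (gelfand_spectrum C). m e \<in> - {0}}"
      by (rule openin_continuous_map_preimage) (simp add: open_Compl)
    also have "{m \<in> topspace (gelfand_spectrum C). m e \<in> - {0}} = {l}"
      using e atom_character_atom[OF C]
      by (auto simp: topspace_gelfand_spectrum characters_eq[OF C])
    finally show ?thesis .
  qed
  then have "openin (gelfand_spectrum C) (\<Union>l\<in>U. {l})"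
    using U by (intro openin_Union) auto
  then show "openin (gelfand_spectrum C) U" by simp
qed (use openin_subset topspace_gelfand_spectrum in metis)

text \<open>The conditions in \<open>riesz_markov_measure\<close> in the form they take on a finite
  discrete spectrum: every subset is Borel and regularity is automatic.\<close>

definition represents :: "('n::finite cmat \<Rightarrow> complex) \<Rightarrow> 'n cmat set
    \<Rightarrow> ('n cmat \<Rightarrow> complex) measure \<Rightarrow> bool" where
  "represents \<psi> C M \<longleftrightarrow> finite_measure M \<and> sets M = Pow (characters C) \<and>
     (\<forall>a\<in>C. integrable M (\<lambda>l. l a) \<and> (\<integral>l. l a \<partial>M) = \<psi> a)"

text \<open>The Gelfand transform of a projection is an indicator function.\<close>

lemma represents_measure_Proj:
  assumes M: "represents \<psi> C M" and p: "p \<in> Proj C"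
  shows "complex_of_real (measure M {l \<in> characters C. l p = 1}) = \<psi> p"
proof -
  interpret finite_measure M
    using M by (simp add: represents_def)
  have sets: "sets M = Pow (characters C)" and int: "(\<integral>l. l p \<partial>M) = \<psi> p"
    using M p by (auto simp: represents_def ProjD)
  have space: "space M = characters C"
    using sets sets_eq_imp_space_eq[of M "count_space (characters C)"] by simp
  have "\<psi> p = (\<integral>l. complex_of_real (indicator {l \<in> characters C. l p = 1} l) \<partial>M)"
    unfolding int[symmetric]
    using character_Proj[OF _ p] by (intro Bochner_Integration.integral_cong) (auto simp: space indicator_def)
  also have "\<dots> = complex_of_real (measure M {l \<in> characters C. l p = 1})"
    by (simp add: integral_complex_of_real space Int_absorb2)
  finally show ?thesis by simp
qed

text \<open>The point belonging to an atom \<open>e\<close> is the set of characters with value 1 at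
  \<open>e\<close>, so both measures give it mass \<open>\<psi> e\<close>.\<close>

lemma represents_unique:
  assumes C: "C \<in> contexts" and M: "represents \<psi> C M" and N: "represents \<psi> C N"
  shows "M = N"
proof (rule measure_eqI_finite[OF _ _ finite_characters[OF C]])
  show "sets M = Pow (characters C)" "sets N = Pow (characters C)"
    using M N by (auto simp: represents_def)
  fix l
  assume "l \<in> characters C"
  then obtain e where e: "e \<in> atoms C" "l = atom_character C e"
    unfolding characters_eq[OF C] by blast
  have *: "{m \<in> characters C. m e = 1} = {l}"
    using e atom_character_atom[OF C] by (auto simp: characters_eq[OF C])
  have "complex_of_real (measure M {l}) = complex_of_real (measure N {l})"
    using represents_measure_Proj[OF M atomsD(1)[OF e(1)]]
      represents_measure_Proj[OF N atomsD(1)[OF e(1)]] by (simp add: *)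
  then show "emeasure M {l} = emeasure N {l}"
    using M N by (simp add: represents_def finite_measure.emeasure_eq_measure)
qed

section \<open>States, and existence of the representing measure\<close>

lemma
  assumes "state \<psi>"
  shows state_add: "\<psi> (a + b) = \<psi> a + \<psi> b"
    and state_cscale: "\<psi> (cscale z a) = z * \<psi> a"
    and state_one: "\<psi> (mat 1) = 1"
    and state_positive: "positive a \<Longrightarrow> \<psi> a \<in> \<real>\<^sub>\<ge>\<^sub>0"
  using assms by (auto simp: state_def clinear_on_def)

lemma state_sum:
  assumes "state \<psi>"
  shows "\<psi> (\<Sum>i\<in>I. f i) = (\<Sum>i\<in>I. \<psi> (f i))"
proof -
  have "\<psi> 0 = 0"
    using state_cscale[OF assms, of 0 0] by simp
  then show ?thesis
    by (induction I rule: infinite_finite_induct) (auto simp: state_add[OF assms])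
qed

lemma state_projection:
  assumes "state \<psi>" "projection p"
  shows "\<psi> p = complex_of_real (Re (\<psi> p))" "0 \<le> Re (\<psi> p)"
  using state_positive[OF assms(1) projection_positive[OF assms(2)]]
  by (auto simp: nonneg_Reals_def)

lemma state_projection_mono:
  assumes \<psi>: "state \<psi>" and "projection p" "projection q" "q ** p = p"
  shows "Re (\<psi> p) \<le> Re (\<psi> q)"
  using state_projection(2)[OF \<psi> projection_compl[OF assms(2-4)]] state_add[OF \<psi>, of "q - p" p]
  by simp

text \<open>Put mass \<open>\<psi> e\<close> on the character of each atom \<open>e\<close>. The
  integral of \<open>a\<close> is then the sum of all \<open>\<psi> (a ** e)\<close>, which is
  \<open>\<psi> a\<close> because the atoms sum to 1.\<close>

lemma represents_exists:
  assumes C: "C \<in> contexts" and \<psi>: "state \<psi>"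
  shows "\<exists>M. represents \<psi> C M"
proof -
  define w where "w l = Re (\<psi> (inv_into (atoms C) (atom_character C) l))" for l
  define M where "M = point_measure (characters C) w"
  have w: "w (atom_character C e) = Re (\<psi> e)" if "e \<in> atoms C" for e
    using that by (simp add: w_def inj_on_atom_character[OF C])
  have w_nonneg: "0 \<le> w l" if "l \<in> characters C" for l
    using that w state_projection(2)[OF \<psi>] by (auto simp: characters_eq[OF C] atomsD)
  have "(\<integral>l. l a \<partial>M) = \<psi> a" if a: "a \<in> C" for a
  proof -
    have "(\<integral>l. l a \<partial>M) = (\<Sum>l\<in>characters C. w l *\<^sub>R l a)"
      unfolding M_def by (intro lebesgue_integral_point_measure_finite finite_characters C w_nonneg)
    also have "\<dots> = (\<Sum>e\<in>atoms C. complex_of_real (Re (\<psi> e)) * atom_character C e a)"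
      unfolding characters_eq[OF C]
      by (subst sum.reindex[OF inj_on_atom_character[OF C]])
        (auto simp: w scaleR_conv_of_real intro!: sum.cong)
    also have "\<dots> = (\<Sum>e\<in>atoms C. \<psi> (a ** e))"
      using a mult_atom[OF C] state_projection(1)[OF \<psi>]
      by (intro sum.cong refl) (simp add: atom_character_def atomsD(3) state_cscale[OF \<psi>] mult.commute)
    also have "\<dots> = \<psi> (a ** (\<Sum>e\<in>atoms C. e))"
      by (simp add: state_sum[OF \<psi>] matrix_sum_mult)
    finally show ?thesis
      by (simp add: sum_atoms[OF C])
  qed
  moreover have "finite_measure M"
    by (rule finite_measureI)
      (simp add: M_def space_point_measure emeasure_point_measure_finite finite_characters[OF C])
  ultimately have "represents \<psi> C M"
    by (auto simp: represents_def M_def sets_point_measure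
        intro: integrable_point_measure_finite finite_characters[OF C])
  then show ?thesis ..
qed

text \<open>The spectrum is finite and discrete, so every finite measure on it is regular.\<close>

lemma riesz_markov_measure:
  assumes C: "C \<in> contexts" and \<psi>: "state \<psi>"
  shows "represents \<psi> C (riesz_markov_measure \<psi> C)"
proof -
  have sigma: "sigma_sets (characters C) (Pow (characters C)) = Pow (characters C)"
    using sigma_algebra.sigma_sets_eq[OF sigma_algebra_Pow] .
  have opens: "{U. openin (gelfand_spectrum C) U} = Pow (characters C)"
    using openin_gelfand_spectrum[OF C] by auto
  \<comment> \<open>Both extrema are attained at \<open>B\<close> itself, which is open by
    discreteness and compact by finiteness.\<close>
  have outer: "\<forall>B\<in>sets M. emeasure M B =
      (INF U\<in>{U. openin (gelfand_spectrum C) U \<and> B \<subseteq> U}. emeasure M U)"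
    if "sets M = Pow (characters C)" for M :: "('a cmat \<Rightarrow> complex) measure"
    using that by (intro ballI antisym INF_greatest INF_lower emeasure_mono)
      (auto simp: openin_gelfand_spectrum[OF C])
  have inner: "\<forall>B\<in>sets M. emeasure M B =
      (SUP K\<in>{K. compactin (gelfand_spectrum C) K \<and> K \<subseteq> B}. emeasure M K)"
    if "sets M = Pow (characters C)" for M :: "('a cmat \<Rightarrow> complex) measure"
    using that finite_subset[OF _ finite_characters[OF C]]
    by (intro ballI antisym SUP_least SUP_upper emeasure_mono)
      (auto intro!: finite_imp_compactin simp: topspace_gelfand_spectrum)
  have space: "space M = characters C" if "sets M = Pow (characters C)"
    for M :: "('a cmat \<Rightarrow> complex) measure"
    using that sets_eq_imp_space_eq[of M "count_space (characters C)"] by simp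
  have "riesz_markov_measure \<psi> C = (THE M. represents \<psi> C M)"
    unfolding riesz_markov_measure_def topspace_gelfand_spectrum opens sigma represents_def
    by (intro arg_cong[of _ _ The] ext iffI; elim conjE; intro conjI;
        (assumption | rule outer inner space; assumption))
  moreover have "\<exists>!M. represents \<psi> C M"
    using represents_exists[OF C \<psi>] represents_unique[OF C] by blast
  ultimately show ?thesis
    by (metis theI')
qed

section \<open>Elementary propositions, their join and its valuation\<close>

lemma restrict_character:
  assumes C: "C \<in> contexts" and D: "D \<in> contexts" "D \<subseteq> C" and l: "l \<in> characters C"
  shows "restrict l D \<in> characters D"
  using charactersD[OF l] D
  by (auto simp: characters_def clinear_on_def context_add context_cscale context_mult context_one subset_iff)

text \<open>Daseinisation grows as the context shrinks: the projection chosen in \<open>D\<close> is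
  a candidate in \<open>C\<close>, so it absorbs the one chosen in \<open>C\<close>. A character
  with value 1 on the smaller projection has value 1 on the larger. Fibres are open by
  discreteness.\<close>

lemma elementary_proposition_open:
  assumes a: "self_adjoint a"
  shows "elementary_proposition a \<Delta> \<in> Sigma_opens"
  unfolding Sigma_opens_def
proof (intro CollectI conjI allI impI ballI)
  let ?P = "spectral_projection \<Delta> a"
  have P: "projection ?P"
    by (rule spectral_projection_projection[OF a])
  show "elementary_proposition a \<Delta> \<subseteq> Sigma_down"
    by (auto simp: elementary_proposition_def)
  then show "openin (gelfand_spectrum C) (fibre (elementary_proposition a \<Delta>) C)" if "C \<in> contexts" for C
    using that by (auto simp: openin_gelfand_spectrum fibre_def Sigma_down_def)
  fix C D l
  assume "(C, l) \<in> elementary_proposition a \<Delta> \<and> D \<in> contexts \<and> D \<subseteq> C"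
  then have C: "C \<in> contexts" and l: "l \<in> characters C" and l1: "l (outer_daseinisation ?P C) = 1"
    and D: "D \<in> contexts" "D \<subseteq> C"
    by (auto simp: elementary_proposition_def Sigma_down_def)
  note dC = outer_daseinisation[OF C P] and dD = outer_daseinisation[OF D(1) P]
  have in_C: "outer_daseinisation ?P D \<in> Proj C"
    using dD(1) Proj_mono[OF D(2)] by blast
  have "l (outer_daseinisation ?P D) * l (outer_daseinisation ?P C) = l (outer_daseinisation ?P C)"
    using charactersD(4)[OF l ProjD(1)[OF in_C] ProjD(1)[OF dC(1)]] dC(3)[OF in_C dD(2)] by simp
  then have "restrict l D (outer_daseinisation ?P D) = 1"
    using l1 dD(1) by (simp add: ProjD)
  then show "(D, restrict l D) \<in> elementary_proposition a \<Delta>"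
    using restrict_character[OF C D l] D by (auto simp: elementary_proposition_def Sigma_down_def)
qed

text \<open>The union of two opens is open, hence their least upper bound under inclusion.
  Uniqueness is shown because the lattice supremum is a choice operator.\<close>

lemma join_Sigma_frame:
  assumes U: "U \<in> Sigma_opens" and V: "V \<in> Sigma_opens"
  shows "U \<squnion>\<^bsub>Sigma_frame\<^esub> V = U \<union> V"
  unfolding join_def Lattice.sup_def
proof (rule some_equality)
  have "fibre (U \<union> V) C = fibre U C \<union> fibre V C" for C
    by (auto simp: fibre_def)
  then have "U \<union> V \<in> Sigma_opens"
    using U V unfolding Sigma_opens_def by (auto intro!: openin_Un)
  then show "least Sigma_frame (U \<union> V) (Upper Sigma_frame {U, V})"
    using U V by (auto simp: least_def Upper_def Sigma_frame_def)
  fix W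
  assume "least Sigma_frame W (Upper Sigma_frame {U, V})"
  with \<open>least Sigma_frame (U \<union> V) (Upper Sigma_frame {U, V})\<close> show "W = U \<union> V"
    unfolding least_def Sigma_frame_def by (simp add: set_eq_subset)
qed

text \<open>Multiplicativity gives \<open>1 - (1 - l p) * (1 - l q)\<close>, and the complex numbers
  have no zero divisors.\<close>

lemma character_sup_proj:
  assumes C: "C \<in> contexts" and l: "l \<in> characters C" and p: "p \<in> Proj C" and q: "q \<in> Proj C"
  shows "l (sup_proj p q) = 1 \<longleftrightarrow> l p = 1 \<or> l q = 1"
proof -
  note Proj_in = ProjD(1)[OF p] ProjD(1)[OF q] context_one[OF C]
  have "l (sup_proj p q) = 1 - (1 - l p) * (1 - l q)"
    unfolding sup_proj_def using Proj_in charactersD(4,5)[OF l]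
    by (simp add: character_diff[OF C l] context_diff[OF C] context_mult[OF C])
  then show ?thesis by simp
qed

text \<open>The fibre of the union at \<open>D\<close> consists of the characters with value 1 at
  the join of the two daseinisations, and the measure of such a set is the state at that
  projection.\<close>

lemma valuation_join:
  fixes a\<^sub>1 a\<^sub>2 :: "'n::finite cmat"
  assumes \<psi>: "state \<psi>" and a: "self_adjoint a\<^sub>1" "self_adjoint a\<^sub>2" and D: "D \<in> contexts"
  shows "complex_of_real (valuation \<psi>
      (elementary_proposition a\<^sub>1 \<Delta>\<^sub>1 \<squnion>\<^bsub>Sigma_frame\<^esub> elementary_proposition a\<^sub>2 \<Delta>\<^sub>2) D) =
    \<psi> (sup_proj (outer_daseinisation (spectral_projection \<Delta>\<^sub>1 a\<^sub>1) D)
                 (outer_daseinisation (spectral_projection \<Delta>\<^sub>2 a\<^sub>2) D))"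
    (is "_ (valuation \<psi> ?U D) = \<psi> (sup_proj ?p ?q)")
proof -
  have pq: "?p \<in> Proj D" "?q \<in> Proj D"
    by (intro outer_daseinisation D spectral_projection_projection a)+
  have "?U = elementary_proposition a\<^sub>1 \<Delta>\<^sub>1 \<union> elementary_proposition a\<^sub>2 \<Delta>\<^sub>2"
    by (intro join_Sigma_frame elementary_proposition_open a)
  then have "fibre ?U D = {l \<in> characters D. l (sup_proj ?p ?q) = 1}"
    using character_sup_proj[OF D _ pq] D
    by (auto simp: fibre_def elementary_proposition_def Sigma_down_def)
  then show ?thesis
    using represents_measure_Proj[OF riesz_markov_measure[OF D \<psi>] sup_proj_Proj[OF D pq]]
    by (simp add: valuation_def)
qed

theorem proposition4p2:
  fixes \<psi> :: "complex ^ 'n ^ 'n \<Rightarrow> complex"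
    and a\<^sub>1 a\<^sub>2 :: "complex ^ 'n ^ 'n"
    and \<Delta>\<^sub>1 \<Delta>\<^sub>2 :: "real set"
    and C :: "(complex ^ 'n ^ 'n) set"
  assumes "state \<psi>"
    and "self_adjoint a\<^sub>1" and "self_adjoint a\<^sub>2"
    and "open \<Delta>\<^sub>1" and "open \<Delta>\<^sub>2"
    and "C \<in> contexts"
  shows "forces_valuation_one \<psi> C
           (elementary_proposition a\<^sub>1 \<Delta>\<^sub>1 \<squnion>\<^bsub>Sigma_frame\<^esub> elementary_proposition a\<^sub>2 \<Delta>\<^sub>2)
     \<longleftrightarrow> (\<forall>p\<in>Proj C. spectral_projection \<Delta>\<^sub>1 a\<^sub>1 \<preceq> p \<and> spectral_projection \<Delta>\<^sub>2 a\<^sub>2 \<preceq> p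
            \<longrightarrow> \<psi> p = 1)"
proof -
  let ?U = "elementary_proposition a\<^sub>1 \<Delta>\<^sub>1 \<squnion>\<^bsub>Sigma_frame\<^esub> elementary_proposition a\<^sub>2 \<Delta>\<^sub>2"
  let ?P = "spectral_projection \<Delta>\<^sub>1 a\<^sub>1" and ?Q = "spectral_projection \<Delta>\<^sub>2 a\<^sub>2"
  define r where "r D = sup_proj (outer_daseinisation ?P D) (outer_daseinisation ?Q D)" for D
  note \<psi> = \<open>state \<psi>\<close> and C = \<open>C \<in> contexts\<close>
  have P: "projection ?P" and Q: "projection ?Q"
    using assms(2,3) by (simp_all add: spectral_projection_projection)
  have val: "valuation \<psi> ?U D = 1 \<longleftrightarrow> \<psi> (r D) = 1" if "D \<in> contexts" for D
    unfolding r_def valuation_join[OF \<psi> assms(2,3) that, symmetric] by simp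
  have r: "r D \<in> Proj D" "r D ** ?P = ?P" "r D ** ?Q = ?Q" if D: "D \<in> contexts" for D
  proof -
    note dP = outer_daseinisation[OF D P] and dQ = outer_daseinisation[OF D Q]
    show "r D \<in> Proj D"
      unfolding r_def by (rule sup_proj_Proj[OF D dP(1) dQ(1)])
    show "r D ** ?P = ?P" "r D ** ?Q = ?Q"
      using sup_proj_upper[OF D dP(1) dQ(1)] dP(2) dQ(2) unfolding r_def
      by (metis matrix_mul_assoc)+
  qed
  have r_least: "p ** r C = r C" if "p \<in> Proj C" "p ** ?P = ?P" "p ** ?Q = ?Q" for p
    unfolding r_def using that by (intro sup_proj_least outer_daseinisation C P Q)
  have le: "?P \<preceq> p \<longleftrightarrow> p ** ?P = ?P" "?Q \<preceq> p \<longleftrightarrow> p ** ?Q = ?Q" if "p \<in> Proj C" for p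
    using that P Q by (auto simp: projection_le_iff ProjD)
  show ?thesis
    unfolding forces_valuation_one_def
  proof (intro iffI ballI impI)
    fix p
    assume one: "\<forall>D\<in>contexts. D \<subseteq> C \<longrightarrow> valuation \<psi> ?U D = 1"
      and p: "p \<in> Proj C" "?P \<preceq> p \<and> ?Q \<preceq> p"
    have pp: "projection p" by (rule ProjD(2)[OF p(1)])
    \<comment> \<open>Only the stage \<open>C\<close> itself is used here: \<open>\<psi> p\<close>
      is squeezed between \<open>\<psi> (r C) = 1\<close> and \<open>\<psi> (mat 1) = 1\<close>,
      first in real parts.\<close>
    have "\<psi> (r C) = 1"
      using one val[OF C] C by blast
    moreover have "Re (\<psi> (r C)) \<le> Re (\<psi> p)"
      using p r(1)[OF C] pp by (intro state_projection_mono \<psi> r_least) (auto simp: le ProjD)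
    moreover have "Re (\<psi> p) \<le> Re (\<psi> (mat 1))"
      using pp by (intro state_projection_mono \<psi> projection_one) auto
    ultimately have "Re (\<psi> p) = 1"
      using state_one[OF \<psi>] by simp
    then show "\<psi> p = 1"
      using state_projection(1)[OF \<psi> pp] by simp
  next
    fix D
    assume one: "\<forall>p\<in>Proj C. ?P \<preceq> p \<and> ?Q \<preceq> p \<longrightarrow> \<psi> p = 1"
      and D: "D \<in> contexts" "D \<subseteq> C"
    \<comment> \<open>At a smaller stage, \<open>r D\<close> is itself a projection of
      \<open>C\<close> above both spectral projections, so the assumption applies to it
      directly.\<close>
    then have "r D \<in> Proj C"
      using r(1)[OF D(1)] Proj_mono[OF D(2)] by blast
    then show "valuation \<psi> ?U D = 1"
      using one r(2,3)[OF D(1)] by (simp add: le val D(1))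
  qed
qed

end
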